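(* Let $G$ be a $4$-boundary regular critical graph in the plane with boundary of size $n$. Then $$f_4(n)=\binom{n/2}{2}+n\quad\text{if } n \text{ is even},\qquad f_4(n)=0\quad\text{otherwise},$$ where $f_4(n)$ is the supremum of the numbers of vertices of $4$-boundary regular critical graphs in the plane with $n$ boundary points.
   Context: Graphs are drawn in the Euclidean plane so that each edge is a straight line segment; edges are allowed to cross each other, and the intersection point of two edges is a vertex of the graph. A boundary point is a vertex incident to only one edge; the set of boundary points is finite, and its cardinality is the size of the boundary. Vertices of degree $2$ are not allowed, the graph is bounded (entirely contained in a bounded open set of the plane), and it has countably many vertices. Such a graph is critical if, at each non-boundary vertex, the sum of the unit vectors of the edges extending from that vertex is zero. It is $4$-boundary regular if every non-boundary vertex has degree $4$. The number of vertices counts all vertices, including boundary points. The quantity $f_4(n)$ is defined for $n\ge 3$; the value $f_4(n)=0$ for odd $n$ expresses that no $4$-boundary regular critical graph with $n$ boundary points exists.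
   Formalization: The vertices are additionally required to have no accumulation point in the plane (so a bounded graph has finitely many vertices); with merely countably many vertices, infinite examples make the supremum infinite for every n. *)

theory Defs
  imports "HOL-Analysis.Analysis" "HOL-Library.Extended_Nat"
begin

text \<open>
  The Euclidean plane is the type \<^typ>\<open>complex\<close>. A graph is given by a set of vertices \<open>V\<close> and a
  set of edges \<open>E\<close>, an edge being the set of its two endpoints. It is drawn as the straight segment
  \<open>convex hull e\<close>.
\<close>

definition drawing :: "complex set \<Rightarrow> complex set set \<Rightarrow> complex set" where
  "drawing V E = V \<union> (\<Union>e\<in>E. convex hull e)"

definition vdegree :: "complex set set \<Rightarrow> complex \<Rightarrow> nat" where
  "vdegree E v = card {e \<in> E. v \<in> e}"

definition boundary :: "complex set \<Rightarrow> complex set set \<Rightarrow> complex set" where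
  "boundary V E = {v \<in> V. vdegree E v = 1}"

text \<open>
  A vertex on an edge is one of its endpoints, so an edge is subdivided at every vertex it passes
  through; together with the condition that points common to two edges are vertices, distinct edges
  meet only in common endpoints.

  The vertex set has no accumulation point in the plane. Boundedness and countability do not imply
  this, and without it \<open>f4 n = \<infinity>\<close> for every \<open>n\<close>: in the Klein disc model of the hyperbolic plane,
  lines are Euclidean chords, so the tiling by right-angled regular pentagons is a bounded graph with
  countably many vertices, all of degree 4 and balanced, and no boundary. One may further add any
  finite number \<open>n\<close> of generic rays, each running from a point inside a tile to the circle at
  infinity, and subdivide at the crossings; this adds exactly \<open>n\<close> boundary points.
\<close>

definition plane_graph :: "complex set \<Rightarrow> complex set set \<Rightarrow> bool" where
  "plane_graph V E \<longleftrightarrow>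
     E \<subseteq> {{u, v} | u v. u \<in> V \<and> v \<in> V \<and> u \<noteq> v} \<and>
     (\<forall>e\<in>E. V \<inter> convex hull e = e) \<and>
     (\<forall>e\<in>E. \<forall>e'\<in>E. e \<noteq> e' \<longrightarrow> convex hull e \<inter> convex hull e' \<subseteq> V) \<and>
     countable V \<and>
     (\<forall>x. \<not> x islimpt V) \<and>
     bounded (drawing V E) \<and>
     finite (boundary V E) \<and>
     (\<forall>v\<in>V. vdegree E v \<noteq> 2)"

text \<open>
  The index set below is finite for every \<open>plane_graph\<close>, whose vertex set is bounded without
  accumulation points.
\<close>

definition critical :: "complex set \<Rightarrow> complex set set \<Rightarrow> bool" where
  "critical V E \<longleftrightarrow> (\<forall>v \<in> V - boundary V E. (\<Sum>w | {v, w} \<in> E. sgn (w - v)) = 0)"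

definition boundary_regular :: "nat \<Rightarrow> complex set \<Rightarrow> complex set set \<Rightarrow> bool" where
  "boundary_regular k V E \<longleftrightarrow> (\<forall>v \<in> V - boundary V E. vdegree E v = k)"

definition num_vertices :: "complex set \<Rightarrow> enat" where
  "num_vertices V = (if finite V then enat (card V) else \<infinity>)"

text \<open>
  In \<^typ>\<open>enat\<close> the supremum of the empty set is \<open>0\<close>. A graph with \<open>n > 0\<close> boundary points has a vertex,
  so for such \<open>n\<close> the value \<open>0\<close> says exactly that no such graph exists.
\<close>

definition f4 :: "nat \<Rightarrow> enat" where
  "f4 n = Sup {num_vertices V | V E.
     plane_graph V E \<and> critical V E \<and> boundary_regular 4 V E \<and> card (boundary V E) = n}"

end

theory Submission
  imports Defs
begin

text \<open>
  Four unit vectors with sum zero form two opposite pairs, so edges run straight through every vertex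
  of degree 4. Order the plane lexicographically. Every vertex of degree 4 has two upward and two
  downward edges, so counting edges by their lower and upper ends shows that exactly half of the
  boundary points have their edge pointing upwards. Following the two downward directions from a
  vertex of degree 4 leads to two such boundary points; as they span two different lines through
  the vertex, they determine it.

  For the lower bound, take segments of the tangents \<open>y = i (x - i)\<close>, \<open>i = 1, \<dots>, m\<close>, of the parabola
  \<open>4 y = x\<^sup>2\<close>. The tangents \<open>i\<close> and \<open>j\<close> meet in \<open>(i + j, i j)\<close>, so no three are concurrent;
  the intersections with the tangents \<open>0\<close> and \<open>m + 1\<close> serve as the boundary points.
\<close>

section \<open>Four unit vectors with sum zero\<close>

text \<open>On the unit circle conjugation is inversion, so conjugating the sum and clearing
  denominators makes the third elementary symmetric polynomial vanish along with the first. Both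
  occur in the expansion of \<open>(a + b) * (a + c) * (a + d)\<close>, which is therefore
  zero.\<close>

lemma unit_quadruple_opposite:
  fixes a b c d :: complex
  assumes "norm a = 1" "norm b = 1" "norm c = 1" "norm d = 1" and sum: "a + b + c + d = 0"
  shows "b = - a \<or> c = - a \<or> d = - a"
proof -
  have inv: "cnj z = inverse z" if "norm z = 1" for z :: complex
    using that by (simp add: inverse_complex_def complex_eq_iff cmod_def)
  have nz: "a \<noteq> 0" "b \<noteq> 0" "c \<noteq> 0" "d \<noteq> 0"
    using assms by auto
  have "cnj a + cnj b + cnj c + cnj d = 0"
    using arg_cong[OF sum, of cnj] by simp
  then have "inverse a + inverse b + inverse c + inverse d = 0"
    using assms by (simp add: inv)
  then have e3: "b * c * d + a * c * d + a * b * d + a * b * c = 0"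
    using nz by (simp add: field_simps)
  have "(a + b) * (a + c) * (a + d) =
      a^2 * (a + b + c + d) + (b * c * d + a * c * d + a * b * d + a * b * c)"
    by (simp add: algebra_simps power2_eq_square)
  then have "(a + b) * (a + c) * (a + d) = 0"
    by (simp add: e3 sum)
  then show ?thesis
    by (auto simp: add_eq_0_iff)
qed

lemma unit_quadruple_uminus_closed:
  fixes S :: "complex set"
  assumes "card S = 4" "\<And>z. z \<in> S \<Longrightarrow> norm z = 1" "\<Sum>S = 0" "z \<in> S"
  shows "- z \<in> S"
proof -
  have fin: "finite S" using assms(1) by (metis card.infinite zero_neq_numeral)
  have "card (S - {z}) = 3" using assms fin by simp
  then obtain b c d where S: "S - {z} = {b, c, d}" "b \<noteq> c" "b \<noteq> d" "c \<noteq> d"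
    by (auto simp: card_3_iff)
  have "\<Sum>S = z + \<Sum>(S - {z})" using fin assms(4) by (simp add: sum.remove)
  then have "z + b + c + d = 0" using S assms(3) by (simp add: add.assoc)
  moreover have bcd: "b \<in> S" "c \<in> S" "d \<in> S" using S(1) by auto
  ultimately have "b = - z \<or> c = - z \<or> d = - z"
    using assms(2,4) by (intro unit_quadruple_opposite) auto
  then show ?thesis using bcd by auto
qed

section \<open>Lexicographic order and directions\<close>

text \<open>The positive cone of the lexicographic order: \<open>lexpos (w - v)\<close> reads as "w
  is above v". The order is total, so no edge is level, not even a vertical one.\<close>

definition lexpos :: "complex \<Rightarrow> bool" where
  "lexpos z \<longleftrightarrow> Re z > 0 \<or> Re z = 0 \<and> Im z > 0"

lemma lexpos_add: "lexpos z \<Longrightarrow> lexpos w \<Longrightarrow> lexpos (z + w)"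
  by (auto simp: lexpos_def)

lemma lexpos_uminus: "z \<noteq> 0 \<Longrightarrow> lexpos (- z) \<longleftrightarrow> \<not> lexpos z"
  by (auto simp: lexpos_def complex_eq_iff)

lemma lexpos_0: "\<not> lexpos 0"
  by (simp add: lexpos_def)

lemma lexpos_scaleR: "r > 0 \<Longrightarrow> lexpos (r *\<^sub>R z) \<longleftrightarrow> lexpos z"
  by (auto simp: lexpos_def zero_less_mult_iff)

lemma lexpos_sgn: "lexpos (sgn z) \<longleftrightarrow> lexpos z"
  by (cases "z = 0") (auto simp: sgn_div_norm lexpos_scaleR)

lemma norm_scaleR_sgn: "norm z *\<^sub>R sgn z = (z :: complex)"
  by (cases "z = 0") (simp_all add: sgn_div_norm)

lemma sgn_add_same:
  fixes z w :: complex
  assumes "sgn z = sgn w"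
  shows "sgn (z + w) = sgn z"
proof (cases "z = 0")
  case True
  then show ?thesis using assms by simp
next
  case False
  have "z = norm z *\<^sub>R sgn z" "w = norm w *\<^sub>R sgn z"
    using norm_scaleR_sgn assms by metis+
  then have "z + w = (norm z + norm w) *\<^sub>R sgn z"
    by (metis scaleR_add_left)
  moreover have "norm z + norm w > 0" using False by (simp add: add_pos_nonneg)
  ultimately show ?thesis
    by (simp add: sgn_scaleR)
qed

text \<open>Both points lie on the ray from \<open>l\<close> with direction \<open>d\<close>, so
  their difference is a real multiple of \<open>d\<close>; the order decides the sign of the
  factor.\<close>

lemma lexpos_sgn_diff:
  fixes v v' l :: complex
  assumes "sgn (v - l) = d" "sgn (v' - l) = d" "lexpos d" "lexpos (v' - v)"
  shows "sgn (v' - v) = d"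
proof -
  have "v - l = norm (v - l) *\<^sub>R d" "v' - l = norm (v' - l) *\<^sub>R d"
    using norm_scaleR_sgn assms(1,2) by metis+
  then have eq: "v' - v = (norm (v' - l) - norm (v - l)) *\<^sub>R d"
    by (metis (no_types) scaleR_diff_left diff_diff_eq2 diff_add_cancel)
  define r where "r = norm (v' - l) - norm (v - l)"
  have "r \<noteq> 0" using eq assms(4) by (auto simp: r_def lexpos_0)
  moreover have "\<not> r < 0"
  proof
    assume "r < 0"
    then have "lexpos ((- r) *\<^sub>R d)" using assms(3) by (subst lexpos_scaleR) auto
    moreover have "(- r) *\<^sub>R d = - (v' - v)" unfolding eq r_def by (rule scaleR_minus_left)
    ultimately have "lexpos (- (v' - v))" by simp
    then show False using assms(4) lexpos_uminus[of "v' - v"] lexpos_0 by fastforce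
  qed
  ultimately have "r > 0" by simp
  then have "sgn (v' - v) = sgn d" using eq by (simp add: r_def sgn_scaleR)
  also have "sgn d = d" using assms(1) by auto
  finally show ?thesis .
qed

section \<open>Neighbours and edge directions in a critical graph of interior degree 4\<close>

text \<open>The index set of the sum in \<open>critical\<close>; degrees, which count edges, are
  transferred to it next.\<close>

definition nbrs :: "complex set set \<Rightarrow> complex \<Rightarrow> complex set" where
  "nbrs E v = {w. {v, w} \<in> E}"

lemma vdegree_eq_card_nbrs:
  assumes "E \<subseteq> {{u, v} | u v. u \<in> V \<and> v \<in> V \<and> u \<noteq> v}"
  shows "vdegree E v = card (nbrs E v)"
proof -
  have "{e \<in> E. v \<in> e} = (\<lambda>w. {v, w}) ` nbrs E v"
  proof (intro equalityI subsetI)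
    fix e assume e: "e \<in> {e \<in> E. v \<in> e}"
    then obtain a b where "e = {a, b}" using assms by blast
    then have "e = {v, a} \<or> e = {v, b}" using e by auto
    then show "e \<in> (\<lambda>w. {v, w}) ` nbrs E v" using e by (auto simp: nbrs_def)
  qed (auto simp: nbrs_def)
  moreover have "inj_on (\<lambda>w. {v, w}) (nbrs E v)"
    by (auto simp: inj_on_def doubleton_eq_iff)
  ultimately show ?thesis by (simp add: vdegree_def card_image)
qed

locale quartic_critical_graph =
  fixes V :: "complex set" and E :: "complex set set"
  assumes plane: "plane_graph V E" and crit: "critical V E" and reg: "boundary_regular 4 V E"
begin

lemma edges: "E \<subseteq> {{u, v} | u v. u \<in> V \<and> v \<in> V \<and> u \<noteq> v}"
  using plane by (simp add: plane_graph_def)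

text \<open>Bolzano-Weierstrass: a bounded infinite set would have an accumulation point.\<close>

lemma finite_vertices: "finite V"
proof -
  have "bounded V"
    using plane by (auto simp: plane_graph_def drawing_def intro: bounded_subset)
  moreover have "\<not> x islimpt V" for x
    using plane by (simp add: plane_graph_def)
  ultimately show ?thesis
    using bounded_infinite_imp_islimpt[of V V] by blast
qed

lemma boundary_subset: "boundary V E \<subseteq> V"
  by (auto simp: boundary_def)

lemma nbrs_subset: "nbrs E v \<subseteq> V - {v}"
  using edges by (auto simp: nbrs_def doubleton_eq_iff)

lemma nbrs_sym: "w \<in> nbrs E v \<longleftrightarrow> v \<in> nbrs E w"
  by (simp add: nbrs_def insert_commute)

lemma finite_nbrs: "finite (nbrs E v)"
  using nbrs_subset finite_vertices by (meson finite_Diff finite_subset)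

lemma card_nbrs_boundary: "v \<in> boundary V E \<Longrightarrow> card (nbrs E v) = 1"
  by (simp add: boundary_def vdegree_eq_card_nbrs[OF edges])

lemma card_nbrs_interior: "v \<in> V - boundary V E \<Longrightarrow> card (nbrs E v) = 4"
  using reg by (auto simp: boundary_regular_def vdegree_eq_card_nbrs[OF edges])

text \<open>Of two neighbours in the same direction, the nearer one would lie on the edge to the
  farther one, but an edge contains no vertices besides its endpoints.\<close>

lemma inj_on_direction: "inj_on (\<lambda>w. sgn (w - v)) (nbrs E v)"
proof -
  have *: "w = w'" if w: "w \<in> nbrs E v" and w': "w' \<in> nbrs E v"
    and eq: "sgn (w - v) = sgn (w' - v)" and le: "norm (w - v) \<le> norm (w' - v)" for w w'
  proof -
    have ne: "w \<noteq> v" "w' \<noteq> v" "w \<in> V" using w w' nbrs_subset by auto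
    define t where "t = norm (w - v) / norm (w' - v)"
    have t: "0 \<le> t" "t \<le> 1" using le ne by (auto simp: t_def)
    have "w - v = norm (w - v) *\<^sub>R sgn (w' - v)"
      using ne unfolding eq[symmetric] by (simp add: sgn_div_norm)
    also have "\<dots> = t *\<^sub>R (w' - v)"
      by (simp add: sgn_div_norm t_def divide_inverse)
    finally have "w = (1 - t) *\<^sub>R v + t *\<^sub>R w'"
      by (simp add: algebra_simps)
    then have "w \<in> convex hull {v, w'}"
      using t by (auto simp: segment_convex_hull[symmetric] in_segment)
    moreover have "V \<inter> convex hull {v, w'} = {v, w'}"
      using plane w' by (auto simp: plane_graph_def nbrs_def)
    ultimately show ?thesis using ne by blast
  qed
  show ?thesis
  proof (intro inj_onI)
    fix w w' assume "w \<in> nbrs E v" "w' \<in> nbrs E v" "sgn (w - v) = sgn (w' - v)"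
    then show "w = w'"
      using *[of w w'] *[of w' w] by (cases "norm (w - v) \<le> norm (w' - v)") auto
  qed
qed

text \<open>The four directions at an interior vertex are distinct unit vectors with sum zero, so
  every edge continues straight through the vertex. Criticality enters only here.\<close>

lemma opposite_nbr:
  assumes "v \<in> V - boundary V E" "w \<in> nbrs E v"
  shows "\<exists>w'\<in>nbrs E v. sgn (w' - v) = - sgn (w - v)"
proof -
  define S where "S = (\<lambda>w. sgn (w - v)) ` nbrs E v"
  have "card S = 4"
    using inj_on_direction card_nbrs_interior[OF assms(1)] by (simp add: S_def card_image)
  moreover have "norm z = 1" if "z \<in> S" for z
    using that nbrs_subset by (fastforce simp: S_def norm_sgn)
  moreover have "\<Sum>S = 0"
    using crit assms(1) inj_on_direction
    by (simp add: S_def sum.reindex critical_def nbrs_def)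
  moreover have "sgn (w - v) \<in> S" using assms(2) by (auto simp: S_def)
  ultimately have "- sgn (w - v) \<in> S" by (rule unit_quadruple_uminus_closed)
  then show ?thesis by (auto simp: S_def)
qed

section \<open>Counting upward and downward edges\<close>

definition up :: "complex \<Rightarrow> complex set" where
  "up v = {w \<in> nbrs E v. lexpos (w - v)}"

definition down :: "complex \<Rightarrow> complex set" where
  "down v = {w \<in> nbrs E v. lexpos (v - w)}"

lemma up_down_card: "card (up v) + card (down v) = card (nbrs E v)"
proof -
  have "lexpos (v - w) \<longleftrightarrow> \<not> lexpos (w - v)" if "w \<in> nbrs E v" for w
    using that nbrs_subset lexpos_uminus[of "w - v"] by force
  then have "up v \<union> down v = nbrs E v" "up v \<inter> down v = {}"
    by (auto simp: up_def down_def)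
  then show ?thesis
    by (metis card_Un_disjoint finite_Un finite_nbrs)
qed

lemma finite_up_down: "finite (up v)" "finite (down v)"
  by (simp_all add: up_def down_def finite_nbrs)

text \<open>Negation maps the upward directions at \<open>v\<close> onto the downward ones, by
  \<open>opposite_nbr\<close>, and directions correspond bijectively to neighbours.\<close>

lemma interior_up_eq_down:
  assumes "v \<in> V - boundary V E"
  shows "card (up v) = card (down v)"
proof -
  let ?s = "\<lambda>w. sgn (w - v)"
  have up_iff: "w \<in> up v \<longleftrightarrow> w \<in> nbrs E v \<and> lexpos (?s w)" for w
    by (simp add: up_def lexpos_sgn)
  have "- ?s w = sgn (v - w)" for w
    using sgn_minus[of "w - v"] by simp
  then have down_iff: "w \<in> down v \<longleftrightarrow> w \<in> nbrs E v \<and> lexpos (- ?s w)" for w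
    by (simp only: down_def lexpos_sgn mem_Collect_eq)
  have "?s ` down v = uminus ` ?s ` up v"
  proof (intro equalityI subsetI)
    fix z assume "z \<in> ?s ` down v"
    then obtain w where w: "w \<in> down v" "z = ?s w" by auto
    then obtain w' where "w' \<in> nbrs E v" "?s w' = - z"
      using opposite_nbr[OF assms] by (auto simp: down_def)
    then have "w' \<in> up v" using w by (simp only: up_iff down_iff)
    then have "- ?s w' \<in> uminus ` ?s ` up v" by blast
    then show "z \<in> uminus ` ?s ` up v" using \<open>?s w' = - z\<close> by simp
  next
    fix z assume "z \<in> uminus ` ?s ` up v"
    then obtain w where w: "w \<in> up v" "z = - ?s w" by auto
    then obtain w' where "w' \<in> nbrs E v" "?s w' = z"
      using opposite_nbr[OF assms] by (auto simp: up_def)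
    then have "w' \<in> down v" using w by (simp add: up_iff down_iff)
    then show "z \<in> ?s ` down v" using \<open>?s w' = z\<close> by blast
  qed
  moreover have "card (?s ` down v) = card (down v)"
    by (intro card_image inj_on_subset[OF inj_on_direction]) (auto simp: down_def)
  moreover have "card (?s ` up v) = card (up v)"
    by (intro card_image inj_on_subset[OF inj_on_direction]) (auto simp: up_def)
  moreover have "card (uminus ` ?s ` up v) = card (?s ` up v)"
    by (intro card_image) (auto simp: inj_on_def)
  ultimately show ?thesis by simp
qed

text \<open>Double counting: the left side counts each edge at its lower end, the right side at its
  upper end.\<close>

lemma sum_up_eq_sum_down: "(\<Sum>v\<in>V. card (up v)) = (\<Sum>v\<in>V. card (down v))"
proof -
  have "w \<in> down v \<longleftrightarrow> v \<in> up w" for v w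
    using nbrs_sym by (auto simp: up_def down_def)
  moreover have "up v \<subseteq> V" "down v \<subseteq> V" for v
    using nbrs_subset by (auto simp: up_def down_def)
  ultimately have "Sigma V down = prod.swap ` Sigma V up"
    by (auto simp: image_iff subset_iff)
  then have "card (Sigma V down) = card (Sigma V up)"
    by (simp add: card_image)
  then show ?thesis
    using finite_vertices finite_up_down by simp
qed

text \<open>Geometrically, the lower ends of the straight lines that make up the drawing.\<close>

definition starts :: "complex set" where
  "starts = {b \<in> boundary V E. up b \<noteq> {}}"

lemma finite_starts: "finite starts"
  using finite_vertices boundary_subset by (auto simp: starts_def intro: finite_subset)

lemma boundary_up_down:
  assumes "b \<in> boundary V E"
  shows "card (up b) = (if b \<in> starts then 1 else 0)" "card (down b) = (if b \<in> starts then 0 else 1)"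
proof -
  have "card (up b) = 0 \<longleftrightarrow> b \<notin> starts"
    using assms finite_up_down by (auto simp: starts_def)
  moreover have "card (up b) + card (down b) = 1"
    using up_down_card card_nbrs_boundary[OF assms] by simp
  ultimately show "card (up b) = (if b \<in> starts then 1 else 0)"
    "card (down b) = (if b \<in> starts then 0 else 1)"
    by (cases "b \<in> starts"; simp)+
qed

text \<open>Interior vertices cancel from the double count, so as many boundary edges point up as
  down. This settles odd \<open>n\<close>.\<close>

lemma card_boundary: "card (boundary V E) = 2 * card starts"
proof -
  have fin: "finite (boundary V E)" using finite_vertices boundary_subset by (rule finite_subset[rotated])
  have "(\<Sum>v\<in>V - boundary V E. card (up v)) + (\<Sum>v\<in>boundary V E. card (up v)) =
    (\<Sum>v\<in>V - boundary V E. card (down v)) + (\<Sum>v\<in>boundary V E. card (down v))"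
    using sum_up_eq_sum_down sum.subset_diff[OF boundary_subset finite_vertices] by metis
  moreover have "(\<Sum>v\<in>V - boundary V E. card (up v)) = (\<Sum>v\<in>V - boundary V E. card (down v))"
    using interior_up_eq_down by simp
  ultimately have "(\<Sum>v\<in>boundary V E. card (up v)) = (\<Sum>v\<in>boundary V E. card (down v))"
    by simp
  moreover have "(\<Sum>v\<in>boundary V E. card (up v)) = card starts"
  proof -
    have "(\<Sum>v\<in>boundary V E. card (up v)) = (\<Sum>v\<in>boundary V E. if v \<in> starts then 1 else 0)"
      by (simp add: boundary_up_down)
    also have "\<dots> = card (boundary V E \<inter> starts)" using fin by (simp add: sum.If_cases)
    also have "boundary V E \<inter> starts = starts" by (auto simp: starts_def)
    finally show ?thesis .
  qed
  moreover have "(\<Sum>v\<in>boundary V E. card (up v)) + (\<Sum>v\<in>boundary V E. card (down v)) = card (boundary V E)"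
    by (simp add: sum.distrib[symmetric] up_down_card card_nbrs_boundary)
  ultimately show ?thesis by simp
qed

section \<open>Tracing lines to the boundary and the upper bound\<close>

text \<open>Meaningful for boundary points, where \<open>nbrs E b\<close> is a singleton.\<close>

definition heading :: "complex \<Rightarrow> complex" where
  "heading b = sgn (the_elem (nbrs E b) - b)"

text \<open>Walk down the line through \<open>v\<close> and \<open>w\<close>: an interior vertex
  passes the line on to its opposite neighbour, and a boundary point ends the walk. Induction is on
  the number of vertices below \<open>v\<close>, which drops because \<open>w\<close> is below
  \<open>v\<close> but not below itself.\<close>

lemma trace_back:
  assumes "v \<in> V" "w \<in> down v"
  shows "\<exists>l\<in>starts. sgn (v - l) = sgn (v - w) \<and> heading l = sgn (v - w)"
  using assms
proof (induction "card {u \<in> V. lexpos (v - u)}" arbitrary: v w rule: less_induct)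
  case less
  have w: "w \<in> nbrs E v" "lexpos (v - w)" "w \<in> V" "v \<in> nbrs E w"
    using less.prems nbrs_subset nbrs_sym by (auto simp: down_def)
  show ?case
  proof (cases "w \<in> boundary V E")
    case True
    then have "nbrs E w = {v}"
      using card_nbrs_boundary[OF True] w(4) by (auto simp: card_1_singleton_iff)
    then have "w \<in> starts" "heading w = sgn (v - w)"
      using True w by (auto simp: starts_def up_def heading_def)
    then show ?thesis by blast
  next
    case False
    then obtain w' where w': "w' \<in> nbrs E w" "sgn (w' - w) = - sgn (v - w)"
      using opposite_nbr[of w v] w by auto
    then have dir: "sgn (w - w') = sgn (v - w)"
      using sgn_minus[of "w' - w"] by simp
    then have "w' \<in> down w"
      using w w' lexpos_sgn[of "v - w"] lexpos_sgn[of "w - w'"] by (simp add: down_def)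
    moreover have "card {u \<in> V. lexpos (w - u)} < card {u \<in> V. lexpos (v - u)}"
    proof (intro psubset_card_mono psubsetI)
      show "{u \<in> V. lexpos (w - u)} \<subseteq> {u \<in> V. lexpos (v - u)}"
        using lexpos_add[OF w(2)] by fastforce
      have "w \<in> {u \<in> V. lexpos (v - u)}" "w \<notin> {u \<in> V. lexpos (w - u)}"
        using w(2,3) lexpos_0 by auto
      then show "{u \<in> V. lexpos (w - u)} \<noteq> {u \<in> V. lexpos (v - u)}" by blast
    qed (simp add: finite_vertices)
    ultimately obtain l where l: "l \<in> starts" "sgn (w - l) = sgn (v - w)" "heading l = sgn (v - w)"
      using less.hyps[of w w'] w(3) dir by auto
    \<comment> \<open>The two pieces of the line have the same direction, hence so does their
      union.\<close>
    have "sgn ((v - w) + (w - l)) = sgn (v - w)" using l by (intro sgn_add_same) simp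
    then show ?thesis using l by auto
  qed
qed

text \<open>\<open>P\<close> is an unordered pair so that a binomial coefficient counts the
  possibilities. Distinct headings force distinct starts and non-parallel lines.\<close>

definition crosses :: "complex \<Rightarrow> complex set \<Rightarrow> bool" where
  "crosses v P \<longleftrightarrow> (\<exists>l\<^sub>1 l\<^sub>2. P = {l\<^sub>1, l\<^sub>2} \<and> l\<^sub>1 \<in> starts \<and> l\<^sub>2 \<in> starts \<and> heading l\<^sub>1 \<noteq> heading l\<^sub>2 \<and>
     (\<forall>l\<in>P. lexpos (heading l) \<and> sgn (v - l) = heading l))"

text \<open>Degree 4 leaves exactly two downward edges. Their directions differ, so tracing both
  back gives starts with different headings.\<close>

lemma crosses_exists:
  assumes "v \<in> V - boundary V E"
  shows "\<exists>P. crosses v P"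
proof -
  have "card (down v) = 2"
    using up_down_card[of v] interior_up_eq_down[OF assms] card_nbrs_interior[OF assms] by simp
  then obtain w\<^sub>1 w\<^sub>2 where w: "w\<^sub>1 \<in> down v" "w\<^sub>2 \<in> down v" "w\<^sub>1 \<noteq> w\<^sub>2"
    by (auto simp: card_2_iff)
  obtain l\<^sub>1 where l1: "l\<^sub>1 \<in> starts" "sgn (v - l\<^sub>1) = sgn (v - w\<^sub>1)" "heading l\<^sub>1 = sgn (v - w\<^sub>1)"
    using trace_back w(1) assms by blast
  obtain l\<^sub>2 where l2: "l\<^sub>2 \<in> starts" "sgn (v - l\<^sub>2) = sgn (v - w\<^sub>2)" "heading l\<^sub>2 = sgn (v - w\<^sub>2)"
    using trace_back w(2) assms by blast
  have "sgn (w\<^sub>1 - v) \<noteq> sgn (w\<^sub>2 - v)"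
    using w inj_onD[OF inj_on_direction[of v]] by (auto simp: down_def)
  then have "sgn (v - w\<^sub>1) \<noteq> sgn (v - w\<^sub>2)"
    using sgn_minus[of "w\<^sub>1 - v"] sgn_minus[of "w\<^sub>2 - v"] by simp
  then have "crosses v {l\<^sub>1, l\<^sub>2}"
    unfolding crosses_def using l1 l2 w
    by (intro exI[of _ l\<^sub>1] exI[of _ l\<^sub>2]) (auto simp: down_def lexpos_sgn)
  then show ?thesis by blast
qed

text \<open>Of two different points one is above the other, and the vector from the lower to the
  upper would have both headings as its direction.\<close>

lemma crosses_unique:
  assumes "crosses v P" "crosses v' P"
  shows "v = v'"
proof -
  have *: False if v: "crosses v P" and v': "crosses v' P" and pos: "lexpos (v' - v)" for v v'
  proof -
    obtain l\<^sub>1 l\<^sub>2 where l: "P = {l\<^sub>1, l\<^sub>2}" "heading l\<^sub>1 \<noteq> heading l\<^sub>2"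
      using v unfolding crosses_def by blast
    have "sgn (v' - v) = heading k" if "k \<in> P" for k
      using that v v' pos unfolding crosses_def
      by (intro lexpos_sgn_diff[of v k "heading k" v']) blast+
    then show False using l by (metis insertI1 insertI2)
  qed
  show ?thesis
    using *[OF assms] *[OF assms(2,1)] lexpos_uminus[of "v - v'"] by fastforce
qed

text \<open>Choosing a crossed pair for each interior vertex is injective, by
  \<open>crosses_unique\<close>.\<close>

lemma card_interior_le: "card (V - boundary V E) \<le> card starts choose 2"
proof -
  obtain P where P: "crosses v (P v)" if "v \<in> V - boundary V E" for v
    using crosses_exists by metis
  have "inj_on P (V - boundary V E)"
    using P crosses_unique by (intro inj_onI) metis
  moreover have "P ` (V - boundary V E) \<subseteq> {K. K \<subseteq> starts \<and> card K = 2}"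
    using P by (force simp: crosses_def card_2_iff)
  moreover have "finite {K. K \<subseteq> starts \<and> card K = 2}"
    using finite_starts by simp
  ultimately have "card (V - boundary V E) \<le> card {K. K \<subseteq> starts \<and> card K = 2}"
    by (rule card_inj_on_le)
  then show ?thesis by (simp add: n_subsets finite_starts)
qed

lemma card_vertices_le: "card V \<le> (card (boundary V E) div 2 choose 2) + card (boundary V E)"
proof -
  have "card V = card (V - boundary V E) + card (boundary V E)"
    using finite_vertices boundary_subset
    by (metis card_Diff_subset card_mono finite_subset le_add_diff_inverse2)
  then show ?thesis using card_interior_le card_boundary by simp
qed

end

section \<open>Intersection points of tangents of the parabola\<close>

text \<open>The meeting point of the tangents \<open>i\<close> and \<open>j\<close>; for
  \<open>i = j\<close> it is the point of tangency.\<close>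

definition tpoint :: "int \<Rightarrow> int \<Rightarrow> complex" where
  "tpoint i j = Complex (of_int (i + j)) (of_int (i * j))"

lemma tpoint_commute: "tpoint i j = tpoint j i"
  by (simp add: tpoint_def algebra_simps)

text \<open>The defect in the equation of tangent \<open>i\<close> factors as
  \<open>(i - k) * (i - l)\<close>. Hence no three tangents are concurrent.\<close>

lemma on_tangent_iff:
  "Im (tpoint k l) = of_int i * (Re (tpoint k l) - of_int i) \<longleftrightarrow> i = k \<or> i = l"
proof -
  have "Im (tpoint k l) - of_int i * (Re (tpoint k l) - of_int i) = of_int ((i - k) * (i - l))"
    by (simp add: tpoint_def algebra_simps)
  then show ?thesis
    by (metis (no_types, opaque_lifting) eq_iff_diff_eq_0 mult_eq_0_iff of_int_eq_0_iff)
qed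

lemma tpoint_eq_iff: "tpoint i j = tpoint k l \<longleftrightarrow> i = k \<and> j = l \<or> i = l \<and> j = k"
proof
  assume eq: "tpoint i j = tpoint k l"
  have "i = k \<or> i = l"
    using on_tangent_iff[of i j i] on_tangent_iff[of k l i] eq by simp
  moreover have "real_of_int (i + j) = real_of_int (k + l)"
    using arg_cong[OF eq, of Re] by (simp add: tpoint_def)
  then have "i + j = k + l" by (simp only: of_int_eq_iff)
  ultimately show "i = k \<and> j = l \<or> i = l \<and> j = k" by auto
qed (auto simp: tpoint_commute)

text \<open>Along tangent \<open>i\<close> the abscissa of \<open>tpoint i j\<close> is
  \<open>i + j\<close>, so points on it are ordered by the second index.\<close>

lemma hull_tpoint:
  assumes "p \<in> convex hull {tpoint i j, tpoint i k}" "j \<le> k"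
  shows "Im p = of_int i * (Re p - of_int i)" "of_int (i + j) \<le> Re p" "Re p \<le> of_int (i + k)"
proof -
  obtain u where u: "0 \<le> u" "u \<le> 1" and p: "p = (1 - u) *\<^sub>R tpoint i j + u *\<^sub>R tpoint i k"
    using assms(1) by (auto simp: segment_convex_hull[symmetric] in_segment)
  show "Im p = of_int i * (Re p - of_int i)"
    by (simp add: p tpoint_def algebra_simps)
  have *: "Re p = of_int (i + j) + u * of_int (k - j)"
    by (simp add: p tpoint_def algebra_simps)
  have "0 \<le> u * of_int (k - j)" "u * of_int (k - j) \<le> of_int (k - j)"
    using u assms(2) by (simp_all add: mult_left_le_one_le)
  then show "of_int (i + j) \<le> Re p" "Re p \<le> of_int (i + k)"
    unfolding * by simp_all
qed

lemma sgn_tpoint_diff: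
  assumes "j < k"
  shows "sgn (tpoint i k - tpoint i j) = sgn (Complex 1 (of_int i))"
    "sgn (tpoint i j - tpoint i k) = - sgn (Complex 1 (of_int i))"
proof -
  have "tpoint i k - tpoint i j = of_int (k - j) *\<^sub>R Complex 1 (of_int i)"
    by (simp add: tpoint_def complex_eq_iff algebra_simps)
  then show "sgn (tpoint i k - tpoint i j) = sgn (Complex 1 (of_int i))"
    using assms by (simp add: sgn_scaleR)
  then show "sgn (tpoint i j - tpoint i k) = - sgn (Complex 1 (of_int i))"
    using sgn_minus[of "tpoint i k - tpoint i j"] by simp
qed

section \<open>The tangent graph and its planarity\<close>

text \<open>\<open>j\<close> and \<open>k\<close> index neighbouring vertices on tangent
  \<open>i\<close>. The point of tangency is not a vertex, so the step from \<open>i - 1\<close>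
  goes directly to \<open>i + 1\<close>. The tangents \<open>0\<close> and \<open>m + 1\<close>
  carry no edges and only cut off the others.\<close>

definition consec :: "int \<Rightarrow> int \<Rightarrow> int \<Rightarrow> int \<Rightarrow> bool" where
  "consec m i j k \<longleftrightarrow> 1 \<le> i \<and> i \<le> m \<and> 0 \<le> j \<and> k \<le> m + 1 \<and>
     (j \<noteq> i \<and> k \<noteq> i \<and> k = j + 1 \<or> j = i - 1 \<and> k = i + 1)"

definition tangent_vertices :: "int \<Rightarrow> complex set" where
  "tangent_vertices m = {tpoint i j | i j. 1 \<le> i \<and> i \<le> m \<and> 0 \<le> j \<and> j \<le> m + 1 \<and> i \<noteq> j}"

definition tangent_edges :: "int \<Rightarrow> complex set set" where
  "tangent_edges m = {{tpoint i j, tpoint i k} | i j k. consec m i j k}"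

lemma finite_tangent_vertices: "finite (tangent_vertices m)"
proof -
  have "tangent_vertices m \<subseteq> (\<lambda>(i, j). tpoint i j) ` ({1..m} \<times> {0..m + 1})"
    by (auto simp: tangent_vertices_def)
  then show ?thesis by (rule finite_subset) simp
qed

lemma tpoint_in_tangent_vertices: "1 \<le> i \<Longrightarrow> i \<le> m \<Longrightarrow> 0 \<le> j \<Longrightarrow> j \<le> m + 1 \<Longrightarrow> i \<noteq> j \<Longrightarrow> tpoint i j \<in> tangent_vertices m"
  unfolding tangent_vertices_def by blast

lemma consec_in_tangent_vertices:
  assumes "consec m i j k"
  shows "tpoint i j \<in> tangent_vertices m" "tpoint i k \<in> tangent_vertices m"
  using assms by (auto simp: consec_def intro!: tpoint_in_tangent_vertices)

lemma tangent_edges_subset: "tangent_edges m \<subseteq> {{u, v} | u v. u \<in> tangent_vertices m \<and> v \<in> tangent_vertices m \<and> u \<noteq> v}"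
proof
  fix e assume "e \<in> tangent_edges m"
  then obtain i j k where e: "e = {tpoint i j, tpoint i k}" "consec m i j k"
    by (auto simp: tangent_edges_def)
  moreover have "tpoint i j \<noteq> tpoint i k"
    using e(2) by (auto simp: tpoint_eq_iff consec_def)
  ultimately show "e \<in> {{u, v} | u v. u \<in> tangent_vertices m \<and> v \<in> tangent_vertices m \<and> u \<noteq> v}"
    using consec_in_tangent_vertices[OF e(2)] by blast
qed

text \<open>A vertex on this edge lies on tangent \<open>i\<close>, so it is some
  \<open>tpoint i l\<close> with \<open>l\<close> between \<open>j\<close> and \<open>k\<close>; no
  admissible index lies strictly between them.\<close>

lemma tangent_vertices_inter_edge:
  assumes "consec m i j k" "p \<in> tangent_vertices m" "p \<in> convex hull {tpoint i j, tpoint i k}"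
  shows "p \<in> {tpoint i j, tpoint i k}"
proof -
  have jk: "j \<le> k" using assms(1) by (auto simp: consec_def)
  obtain a b where "p = tpoint a b" "a \<noteq> b" using assms(2) by (auto simp: tangent_vertices_def)
  moreover have "i = a \<or> i = b"
    using hull_tpoint(1)[OF assms(3) jk] calculation on_tangent_iff by metis
  ultimately obtain l where p: "p = tpoint i l" "l \<noteq> i"
    by (metis tpoint_commute)
  have "real_of_int (i + j) \<le> of_int (i + l)" "real_of_int (i + l) \<le> of_int (i + k)"
    using hull_tpoint(2,3)[OF assms(3) jk] by (simp_all add: p tpoint_def)
  then have "j \<le> l" "l \<le> k" by linarith+
  then have "l = j \<or> l = k"
    using p assms(1) by (auto simp: consec_def)
  then show ?thesis using p by auto
qed

text \<open>Different tangents \<open>i\<close> and \<open>i'\<close> meet only in the vertex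
  \<open>tpoint i i'\<close>. On one tangent the index intervals of two edges share at most an
  endpoint.\<close>

lemma edges_meet_in_tangent_vertices:
  assumes "consec m i j k" "consec m i' j' k'" "(i, j, k) \<noteq> (i', j', k')"
    "p \<in> convex hull {tpoint i j, tpoint i k}" "p \<in> convex hull {tpoint i' j', tpoint i' k'}"
  shows "p \<in> tangent_vertices m"
proof -
  have jk: "j \<le> k" "j' \<le> k'" using assms(1,2) by (auto simp: consec_def)
  note h = hull_tpoint[OF assms(4) jk(1)] and h' = hull_tpoint[OF assms(5) jk(2)]
  show ?thesis
  proof (cases "i = i'")
    case False
    have "of_int i * (Re p - of_int i) = of_int i' * (Re p - of_int i')"
      using h(1) h'(1) by simp
    then have "(of_int i - of_int i') * (Re p - of_int (i + i')) = 0"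
      by (simp add: algebra_simps)
    then have "Re p = of_int (i + i')" using False by simp
    then have "p = tpoint i i'" using h(1) by (simp add: tpoint_def complex_eq_iff)
    then show ?thesis using False assms(1,2) by (auto simp: consec_def intro!: tpoint_in_tangent_vertices)
  next
    case True
    have "real_of_int (i + j) \<le> of_int (i + k')" "real_of_int (i + j') \<le> of_int (i + k)"
      using h h' True by linarith+
    then have "j \<le> k'" "j' \<le> k" by linarith+
    then have "k = j' \<or> k' = j" using assms(1-3) True by (auto simp: consec_def)
    then have "Re p = of_int (i + k) \<or> Re p = of_int (i + j)"
      using h(2,3) h'(2,3) True by auto
    then have "p = tpoint i k \<or> p = tpoint i j"
      using h(1) by (auto simp: tpoint_def complex_eq_iff)
    then show ?thesis
      using consec_in_tangent_vertices[OF assms(1)] by auto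
  qed
qed

section \<open>Degrees and balance in the tangent graph\<close>

definition next_on :: "int \<Rightarrow> int \<Rightarrow> int" where
  "next_on i j = (if j + 1 = i then j + 2 else j + 1)"

definition prev_on :: "int \<Rightarrow> int \<Rightarrow> int" where
  "prev_on i j = (if j - 1 = i then j - 2 else j - 1)"

lemma consec_next:
  "{k. consec m i j k} = (if 1 \<le> i \<and> i \<le> m \<and> 0 \<le> j \<and> j \<le> m \<and> j \<noteq> i then {next_on i j} else {})"
  by (auto simp: consec_def next_on_def)

lemma consec_prev:
  "{k. consec m i k j} = (if 1 \<le> i \<and> i \<le> m \<and> 1 \<le> j \<and> j \<le> m + 1 \<and> j \<noteq> i then {prev_on i j} else {})"
  by (auto simp: consec_def prev_on_def)

text \<open>The point lies on both tangents, and neighbours on each are found by moving the other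
  index. A tangent outside \<open>1..m\<close> contributes nothing, which is why the end points have
  fewer neighbours.\<close>

lemma nbrs_tangent_edges:
  "nbrs (tangent_edges m) (tpoint i j) =
     tpoint i ` ({k. consec m i j k} \<union> {k. consec m i k j}) \<union>
     tpoint j ` ({k. consec m j i k} \<union> {k. consec m j k i})"
  (is "?L = ?R")
proof (intro equalityI subsetI)
  fix w assume "w \<in> ?L"
  then obtain a b c where "consec m a b c" "{tpoint i j, w} = {tpoint a b, tpoint a c}"
    by (auto simp: nbrs_def tangent_edges_def)
  then show "w \<in> ?R"
    by (auto simp: doubleton_eq_iff tpoint_eq_iff)
next
  fix w assume "w \<in> ?R"
  then consider k where "w = tpoint i k" "consec m i j k" | k where "w = tpoint i k" "consec m i k j"
    | k where "w = tpoint j k" "consec m j i k" | k where "w = tpoint j k" "consec m j k i"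
    by blast
  then have "{tpoint i j, w} \<in> tangent_edges m"
  proof cases
    case 1
    then show ?thesis unfolding tangent_edges_def by blast
  next
    case 2
    then have "{tpoint i j, w} = {tpoint i k, tpoint i j}" by auto
    then show ?thesis using 2 unfolding tangent_edges_def by blast
  next
    case 3
    then have "{tpoint i j, w} = {tpoint j i, tpoint j k}" by (simp add: tpoint_commute)
    then show ?thesis using 3 unfolding tangent_edges_def by blast
  next
    case 4
    then have "{tpoint i j, w} = {tpoint j k, tpoint j i}" by (auto simp: tpoint_commute)
    then show ?thesis using 4 unfolding tangent_edges_def by blast
  qed
  then show "w \<in> ?L" by (simp add: nbrs_def)
qed

lemma nbrs_tangent_edges_interior:
  assumes "1 \<le> i" "i \<le> m" "1 \<le> j" "j \<le> m" "i \<noteq> j"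
  shows "nbrs (tangent_edges m) (tpoint i j) =
    {tpoint i (next_on i j), tpoint i (prev_on i j), tpoint j (next_on j i), tpoint j (prev_on j i)}"
  using assms unfolding nbrs_tangent_edges consec_next consec_prev by auto

lemma nbrs_tangent_edges_interior_distinct:
  assumes "i \<noteq> j"
  shows "distinct [tpoint i (next_on i j), tpoint i (prev_on i j), tpoint j (next_on j i), tpoint j (prev_on j i)]"
  using assms by (auto simp: tpoint_eq_iff next_on_def prev_on_def)

lemma vdegree_tangent_edges_interior:
  assumes "1 \<le> i" "i \<le> m" "1 \<le> j" "j \<le> m" "i \<noteq> j"
  shows "vdegree (tangent_edges m) (tpoint i j) = 4"
  using nbrs_tangent_edges_interior_distinct[OF assms(5)]
  by (simp add: vdegree_eq_card_nbrs[OF tangent_edges_subset] nbrs_tangent_edges_interior[OF assms])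

text \<open>The two edges along each tangent leave in opposite directions and cancel.\<close>

lemma sum_sgn_tangent_edges_interior:
  assumes "1 \<le> i" "i \<le> m" "1 \<le> j" "j \<le> m" "i \<noteq> j"
  shows "(\<Sum>w\<in>nbrs (tangent_edges m) (tpoint i j). sgn (w - tpoint i j)) = 0"
proof -
  have up: "a < next_on b a" and down: "prev_on b a < a" for a b
    by (auto simp: next_on_def prev_on_def)
  have *: "sgn (tpoint a (next_on a b) - tpoint a b) = sgn (Complex 1 (of_int a))"
    "sgn (tpoint a (prev_on a b) - tpoint a b) = - sgn (Complex 1 (of_int a))" for a b
    using sgn_tpoint_diff(1)[OF up] sgn_tpoint_diff(2)[OF down] by auto
  \<comment> \<open>Rewriting \<open>tpoint j i\<close> as \<open>tpoint i j\<close> refers all four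
    differences to the same centre.\<close>
  note * = *[of i j] *[of j i, unfolded tpoint_commute[of j i]]
  then show ?thesis
    using nbrs_tangent_edges_interior_distinct[OF assms(5)] by (simp add: nbrs_tangent_edges_interior[OF assms] *)
qed

text \<open>Only tangent \<open>i\<close> contributes, and only on one side, since \<open>j\<close>
  is the first or last index on it.\<close>

lemma vdegree_tangent_edges_end:
  assumes "1 \<le> i" "i \<le> m" "j = 0 \<or> j = m + 1"
  shows "vdegree (tangent_edges m) (tpoint i j) = 1"
proof -
  have "{k. consec m i j k} \<union> {k. consec m i k j} = {if j = 0 then next_on i 0 else prev_on i (m + 1)}"
    "{k. consec m j i k} \<union> {k. consec m j k i} = {}"
    using assms by (auto simp: consec_next consec_prev)
  then show ?thesis
    by (simp add: vdegree_eq_card_nbrs[OF tangent_edges_subset] nbrs_tangent_edges)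
qed

section \<open>Counting the vertices of the tangent graph\<close>

lemma boundary_tangent_vertices: "boundary (tangent_vertices m) (tangent_edges m) = (\<lambda>(i, j). tpoint i j) ` ({1..m} \<times> {0, m + 1})"
proof (intro equalityI subsetI)
  fix v assume "v \<in> boundary (tangent_vertices m) (tangent_edges m)"
  then obtain i j where v: "v = tpoint i j" "1 \<le> i" "i \<le> m" "0 \<le> j" "j \<le> m + 1" "i \<noteq> j"
    and deg: "vdegree (tangent_edges m) v = 1"
    by (auto simp: boundary_def tangent_vertices_def)
  have "\<not> (1 \<le> j \<and> j \<le> m)" using v deg vdegree_tangent_edges_interior[of i m j] by auto
  then have "j = 0 \<or> j = m + 1" using v by auto
  then show "v \<in> (\<lambda>(i, j). tpoint i j) ` ({1..m} \<times> {0, m + 1})" using v by force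
next
  fix v assume "v \<in> (\<lambda>(i, j). tpoint i j) ` ({1..m} \<times> {0, m + 1})"
  then obtain i j where v: "v = tpoint i j" "1 \<le> i" "i \<le> m" "j = 0 \<or> j = m + 1" by auto
  then have "v \<in> tangent_vertices m" by (auto intro!: tpoint_in_tangent_vertices)
  then show "v \<in> boundary (tangent_vertices m) (tangent_edges m)"
    using v vdegree_tangent_edges_end[of i m j] by (auto simp: boundary_def)
qed

text \<open>Putting the larger index first picks one representative of each unordered pair, so
  \<open>tpoint\<close> is injective on the index set.\<close>

lemma interior_tangent_vertices:
  "tangent_vertices m - boundary (tangent_vertices m) (tangent_edges m) = (\<lambda>(i, j). tpoint i j) ` (SIGMA i:{1..m}. {1..<i})"
proof (intro equalityI subsetI)
  fix v assume v: "v \<in> tangent_vertices m - boundary (tangent_vertices m) (tangent_edges m)"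
  then obtain i j where ij: "v = tpoint i j" "1 \<le> i" "i \<le> m" "0 \<le> j" "j \<le> m + 1" "i \<noteq> j"
    by (auto simp: tangent_vertices_def)
  then have "j \<noteq> 0" "j \<noteq> m + 1" using v by (auto simp: boundary_tangent_vertices)
  then have "1 \<le> j" "j \<le> m" using ij by auto
  then have "(i, j) \<in> (SIGMA i:{1..m}. {1..<i}) \<or> (j, i) \<in> (SIGMA i:{1..m}. {1..<i})"
    using ij by auto
  moreover have "v = (\<lambda>(i, j). tpoint i j) (i, j)" "v = (\<lambda>(i, j). tpoint i j) (j, i)"
    using ij tpoint_commute[of i j] by auto
  ultimately show "v \<in> (\<lambda>(i, j). tpoint i j) ` (SIGMA i:{1..m}. {1..<i})"
    by (metis imageI)
next
  fix v assume "v \<in> (\<lambda>(i, j). tpoint i j) ` (SIGMA i:{1..m}. {1..<i})"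
  then obtain i j where v: "v = tpoint i j" "1 \<le> i" "i \<le> m" "1 \<le> j" "j < i" by auto
  then have "v \<in> tangent_vertices m" by (auto intro!: tpoint_in_tangent_vertices)
  then show "v \<in> tangent_vertices m - boundary (tangent_vertices m) (tangent_edges m)"
    using v vdegree_tangent_edges_interior[of i m j] by (auto simp: boundary_def)
qed

lemma card_boundary_tangent_vertices: "card (boundary (tangent_vertices (int m)) (tangent_edges (int m))) = 2 * m"
proof -
  have "inj_on (\<lambda>(i, j). tpoint i j) ({1..int m} \<times> {0, int m + 1})"
    by (auto simp: inj_on_def tpoint_eq_iff)
  then show ?thesis by (simp add: boundary_tangent_vertices card_image card_cartesian_product)
qed

lemma card_interior_tangent_vertices: "card (tangent_vertices (int m) - boundary (tangent_vertices (int m)) (tangent_edges (int m))) = m choose 2"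
proof -
  have "inj_on (\<lambda>(i, j). tpoint i j) (SIGMA i:{1..int m}. {1..<i})"
    by (auto simp: inj_on_def tpoint_eq_iff)
  then have "card (tangent_vertices (int m) - boundary (tangent_vertices (int m)) (tangent_edges (int m))) = (\<Sum>i\<in>{1..int m}. nat (i - 1))"
    by (simp add: interior_tangent_vertices card_image)
  \<comment> \<open>The shift \<open>i - 1\<close> turns the range from \<open>1\<close> to
    \<open>m\<close> into \<open>0\<close> to \<open>m - 1\<close>.\<close>
  also have "\<dots> = (\<Sum>i<m. i)"
    by (intro sum.reindex_bij_witness[of _ "\<lambda>i. int i + 1" "\<lambda>i. nat (i - 1)"]) auto
  also have "\<dots> = m choose 2"
    by (induction m) (simp_all add: numeral_2_eq_2)
  finally show ?thesis .
qed

lemma card_tangent_vertices: "card (tangent_vertices (int m)) = (m choose 2) + 2 * m"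
proof -
  let ?B = "boundary (tangent_vertices (int m)) (tangent_edges (int m))"
  have B: "?B \<subseteq> tangent_vertices (int m)" by (auto simp: boundary_def)
  have "card (tangent_vertices (int m)) = card (tangent_vertices (int m) - ?B) + card ?B"
    using card_Diff_subset[OF finite_subset[OF B finite_tangent_vertices] B] card_mono[OF finite_tangent_vertices B] by simp
  then show ?thesis
    by (simp add: card_interior_tangent_vertices card_boundary_tangent_vertices)
qed

lemma vdegree_tangent_edges_not_boundary:
  assumes "v \<in> tangent_vertices m - boundary (tangent_vertices m) (tangent_edges m)"
  shows "vdegree (tangent_edges m) v = 4"
  using assms vdegree_tangent_edges_interior unfolding interior_tangent_vertices by auto

section \<open>The tangent graph is admissible\<close>

lemma plane_graph_tangents: "plane_graph (tangent_vertices m) (tangent_edges m)"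
  unfolding plane_graph_def
proof (intro conjI ballI impI)
  show "tangent_edges m \<subseteq> {{u, v} | u v. u \<in> tangent_vertices m \<and> v \<in> tangent_vertices m \<and> u \<noteq> v}" by (rule tangent_edges_subset)
next
  fix e assume e: "e \<in> tangent_edges m"
  then obtain i j k where "e = {tpoint i j, tpoint i k}" "consec m i j k" by (auto simp: tangent_edges_def)
  moreover have "e \<subseteq> tangent_vertices m" using e tangent_edges_subset by fastforce
  ultimately show "tangent_vertices m \<inter> convex hull e = e"
    using tangent_vertices_inter_edge hull_subset[of e convex] by blast
next
  fix e e' assume e: "e \<in> tangent_edges m" "e' \<in> tangent_edges m" "e \<noteq> e'"
  then obtain i j k i' j' k' where "e = {tpoint i j, tpoint i k}" "consec m i j k"
    "e' = {tpoint i' j', tpoint i' k'}" "consec m i' j' k'" "(i, j, k) \<noteq> (i', j', k')"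
    unfolding tangent_edges_def by blast
  then show "convex hull e \<inter> convex hull e' \<subseteq> tangent_vertices m"
    using edges_meet_in_tangent_vertices by blast
next
  show "countable (tangent_vertices m)" by (simp add: finite_tangent_vertices countable_finite)
  show "\<forall>x. \<not> x islimpt tangent_vertices m" by (simp add: finite_tangent_vertices islimpt_finite)
  have "e \<subseteq> tangent_vertices m" if "e \<in> tangent_edges m" for e using that tangent_edges_subset by fastforce
  \<comment> \<open>Boundedness is inherited from the convex hull of finitely many points.\<close>
  then have "drawing (tangent_vertices m) (tangent_edges m) \<subseteq> convex hull tangent_vertices m"
    unfolding drawing_def using hull_subset[of "tangent_vertices m" convex] hull_mono[of _ "tangent_vertices m" convex] by blast
  then show "bounded (drawing (tangent_vertices m) (tangent_edges m))"
    by (meson bounded_convex_hull bounded_subset finite_tangent_vertices finite_imp_bounded)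
  show "finite (boundary (tangent_vertices m) (tangent_edges m))" by (simp add: boundary_tangent_vertices)
next
  fix v assume "v \<in> tangent_vertices m"
  then show "vdegree (tangent_edges m) v \<noteq> 2"
    using vdegree_tangent_edges_not_boundary[of v m] by (cases "v \<in> boundary (tangent_vertices m) (tangent_edges m)") (auto simp: boundary_def)
qed

lemma critical_tangents: "critical (tangent_vertices m) (tangent_edges m)"
  unfolding critical_def interior_tangent_vertices
  using sum_sgn_tangent_edges_interior[of _ m] by (auto simp: nbrs_def)

lemma boundary_regular_tangents: "boundary_regular 4 (tangent_vertices m) (tangent_edges m)"
  by (simp add: boundary_regular_def vdegree_tangent_edges_not_boundary)

section \<open>The value of \<open>f4\<close>: upper bound and attainment\<close>

theorem theorem2:
  fixes n :: nat
  assumes "n \<ge> 3"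
  shows "f4 n = (if even n then enat (((n div 2) choose 2) + n) else 0)"
proof -
  define A where "A = {num_vertices V | V E.
     plane_graph V E \<and> critical V E \<and> boundary_regular 4 V E \<and> card (boundary V E) = n}"
  have f4: "f4 n = Sup A" by (simp add: f4_def A_def)
  have bound: "even n \<and> x \<le> enat ((n div 2 choose 2) + n)" if x: "x \<in> A" for x
  proof -
    obtain V E where x_eq: "x = num_vertices V"
      and G: "plane_graph V E" "critical V E" "boundary_regular 4 V E" and n: "card (boundary V E) = n"
      using x by (auto simp: A_def)
    interpret quartic_critical_graph V E by unfold_locales (fact G)+
    show ?thesis
      using card_boundary card_vertices_le finite_vertices by (simp add: x_eq n num_vertices_def)
  qed
  show ?thesis
  proof (cases "even n")
    case False
    \<comment> \<open>Any member of \<open>A\<close> would make \<open>n\<close> even; the supremum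
      of the empty set is the bottom element \<open>0\<close> of \<open>enat\<close>.\<close>
    then have "A = {}" using bound by blast
    then show ?thesis using False by (simp add: f4 bot_enat_def)
  next
    case True
    then obtain m where m: "n = 2 * m" by (rule evenE)
    \<comment> \<open>With \<open>m = n div 2\<close> tangents the graph has \<open>n\<close>
      boundary points and attains the bound, so the supremum is a maximum.\<close>
    have "num_vertices (tangent_vertices (int m)) \<in> A"
      unfolding A_def
      using plane_graph_tangents critical_tangents boundary_regular_tangents card_boundary_tangent_vertices[of m] m by blast
    moreover have "num_vertices (tangent_vertices (int m)) = enat ((n div 2 choose 2) + n)"
      by (simp add: num_vertices_def finite_tangent_vertices card_tangent_vertices m)
    ultimately have "Sup A = enat ((n div 2 choose 2) + n)"
      using bound by (intro antisym Sup_least Sup_upper) auto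
    then show ?thesis using True by (simp add: f4)
  qed
qed

end
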